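(* Let $(\mathrm{i},\mathrm{e})$ be a Galois connection on a pair of (finite) lattices $(X,L)$, and let $F$ be a subconfluence of $L$ with associated interior operators $\{p_t\}_{t\in F}$. Then the map $f:F\to F$ defined by $$\forall t\in F,\quad f(t)=p_t\circ \mathrm{i}\circ \mathrm{e}(t)$$ is a closure operator on $F$.
   Context: All ordered sets are finite. For an ordered set $E$ and $t\in E$: $E^t=\{x\in E: x\ge t\}$, $E_t=\{x\in E: x\le t\}$. A (finite) ordered set $F$ is a confluence if for every $t\in F$, $F^t$ is a meet-semilattice with a greatest element (hence, by finiteness, a lattice). A subset $F$ of a lattice $L$ is a subconfluence of $L$ if, with the induced order, $F$ is a confluence and for all $t\in F$ and $x,y\in F^t$ the join of $x,y$ in $F^t$ equals their join $x\vee y$ in $L$. For $t\in F$ the associated interior operator $p_t:L^t\to L^t$ is $p_t(x)=\bigvee_{q\in F^t\cap L_x} q$ (join in $L$); it has range $F^t$. A Galois connection on $(X,L)$ is a pair of maps $\mathrm{i}:X\to L$, $\mathrm{e}:L\to X$, both order-reversing, with $\mathrm{e}\circ\mathrm{i}(x)\ge x$ for all $x\in X$ and $\mathrm{i}\circ\mathrm{e}(l)\ge l$ for all $l\in L$. A closure operator on an ordered set is a monotone, idempotent, extensive self-map. *)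

theory Defs
  imports Main
begin

definition meet_on :: "'a::order set \<Rightarrow> 'a \<Rightarrow> 'a \<Rightarrow> 'a \<Rightarrow> bool" where
  "meet_on A x y m \<longleftrightarrow> m \<in> A \<and> m \<le> x \<and> m \<le> y \<and> (\<forall>z\<in>A. z \<le> x \<and> z \<le> y \<longrightarrow> z \<le> m)"

definition join_on :: "'a::order set \<Rightarrow> 'a \<Rightarrow> 'a \<Rightarrow> 'a \<Rightarrow> bool" where
  "join_on A x y j \<longleftrightarrow> j \<in> A \<and> x \<le> j \<and> y \<le> j \<and> (\<forall>z\<in>A. x \<le> z \<and> y \<le> z \<longrightarrow> j \<le> z)"

definition meet_semilattice_on :: "'a::order set \<Rightarrow> bool" where
  "meet_semilattice_on A \<longleftrightarrow> (\<forall>x\<in>A. \<forall>y\<in>A. \<exists>m. meet_on A x y m)"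

definition has_greatest :: "'a::order set \<Rightarrow> bool" where
  "has_greatest A \<longleftrightarrow> (\<exists>g\<in>A. \<forall>x\<in>A. x \<le> g)"

definition upper_part :: "'a::order set \<Rightarrow> 'a \<Rightarrow> 'a set" where
  "upper_part F t = F \<inter> {t..}"

definition confluence :: "'a::order set \<Rightarrow> bool" where
  "confluence F \<longleftrightarrow> finite F \<and>
    (\<forall>t\<in>F. meet_semilattice_on (upper_part F t) \<and> has_greatest (upper_part F t))"

definition subconfluence :: "'a::lattice set \<Rightarrow> bool" where
  "subconfluence F \<longleftrightarrow> confluence F \<and>
    (\<forall>t\<in>F. \<forall>x\<in>upper_part F t. \<forall>y\<in>upper_part F t. join_on (upper_part F t) x y (sup x y))"

text \<open>
  Only meaningful for \<open>t \<in> F\<close> and \<open>t \<le> x\<close>: then the set contains \<open>t\<close>, so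
  \<open>Sup_fin\<close> (unspecified on the empty set) is applied to a nonempty set.
\<close>
definition interior_op :: "'a::lattice set \<Rightarrow> 'a \<Rightarrow> 'a \<Rightarrow> 'a" where
  "interior_op F t x = Sup_fin (upper_part F t \<inter> {..x})"

text \<open>Galois connections here are antitone.\<close>
definition galois_connection :: "('x::order \<Rightarrow> 'l::order) \<Rightarrow> ('l \<Rightarrow> 'x) \<Rightarrow> bool" where
  "galois_connection i e \<longleftrightarrow> antimono i \<and> antimono e \<and>
    (\<forall>x. x \<le> (e \<circ> i) x) \<and> (\<forall>l. l \<le> (i \<circ> e) l)"

definition closure_operator_on :: "'a::order set \<Rightarrow> ('a \<Rightarrow> 'a) \<Rightarrow> bool" where
  "closure_operator_on F f \<longleftrightarrow> f ` F \<subseteq> F \<and> mono_on F f \<and>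
    (\<forall>t\<in>F. f (f t) = f t) \<and> (\<forall>t\<in>F. t \<le> f t)"

end

theory Submission
  imports Defs
begin

text \<open>
  For \<open>x \<ge> t\<close>, the element \<open>p\<^sub>t x\<close> is the greatest element of \<open>F\<close> between \<open>t\<close> and \<open>x\<close>. If \<open>s \<le> t\<close>
  in \<open>F\<close>, then \<open>f s\<close> and \<open>t\<close> both lie above \<open>s\<close>, so \<open>f s \<squnion> t\<close> belongs to \<open>F\<close>; it lies between \<open>t\<close>
  and \<open>i (e t)\<close>, hence below \<open>f t\<close>. Idempotence of \<open>f\<close> is inherited from that of \<open>i \<circ> e\<close>.
\<close>

text \<open>Keeping \<open>B\<close> apart from \<open>A\<close> lets the induction build up
  \<open>A\<close> while the closed set stays fixed; the use below takes \<open>A\<close> =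
  \<open>B\<close>.\<close>

lemma Sup_fin_in_sup_closed:
  fixes A :: "'a::semilattice_sup set"
  assumes "finite A" and "A \<noteq> {}" and "\<And>x y. x \<in> B \<Longrightarrow> y \<in> B \<Longrightarrow> sup x y \<in> B" and "A \<subseteq> B"
  shows "Sup_fin A \<in> B"
  using assms(1,2,4) by (induction rule: finite_ne_induct) (auto intro: assms(3))

lemma galois_connection_closure:
  assumes "galois_connection i e"
  shows "mono (i \<circ> e)" and "l \<le> (i \<circ> e) l" and "(i \<circ> e) ((i \<circ> e) l) = (i \<circ> e) l"
proof -
  have anti: "antimono i" "antimono e"
    and ext: "\<And>x. x \<le> e (i x)" "\<And>l. l \<le> i (e l)"
    using assms by (auto simp: galois_connection_def)
  show "mono (i \<circ> e)"
    using anti by (auto intro!: monoI dest: antimonoD)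
  show "l \<le> (i \<circ> e) l"
    using ext(2) by simp
  show "(i \<circ> e) ((i \<circ> e) l) = (i \<circ> e) l"
    \<comment> \<open>Applying the antitone \<open>i\<close> to \<open>x \<le> e (i x)\<close> at
      \<open>x = e l\<close> gives the nontrivial inequality.\<close>
    using antimonoD[OF anti(1) ext(1)] ext(2) by (simp add: order.eq_iff)
qed

text \<open>The common lower bound \<open>t\<close> must itself lie in \<open>F\<close>: a
  two-element antichain can be a subconfluence without containing its join.\<close>

lemma subconfluence_sup:
  assumes "subconfluence F" and "t \<in> F" and "x \<in> F" and "t \<le> x" and "y \<in> F" and "t \<le> y"
  shows "sup x y \<in> F"
  using assms unfolding subconfluence_def join_on_def upper_part_def by blast

lemma interior_op_upper:
  assumes "finite F" and "q \<in> F" and "t \<le> q" and "q \<le> x"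
  shows "q \<le> interior_op F t x"
  using assms unfolding interior_op_def upper_part_def by (intro Sup_fin.coboundedI) auto

lemma
  assumes sub: "subconfluence F" and t: "t \<in> F" "t \<le> x"
  shows interior_op_in: "interior_op F t x \<in> F"
    and interior_op_ge: "t \<le> interior_op F t x"
    and interior_op_le: "interior_op F t x \<le> x"
proof -
  have fin: "finite F"
    using sub by (simp add: subconfluence_def confluence_def)
  show "t \<le> interior_op F t x"
    using fin t by (intro interior_op_upper) auto
  \<comment> \<open>The set defining \<open>interior_op\<close> contains \<open>t\<close> and is
    closed under joins, so it contains its own supremum.\<close>
  have "interior_op F t x \<in> upper_part F t \<inter> {..x}"
    unfolding interior_op_def
    using fin t subconfluence_sup[OF sub t(1)]
    by (intro Sup_fin_in_sup_closed) (auto simp: upper_part_def intro: le_supI1)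
  then show "interior_op F t x \<in> F" and "interior_op F t x \<le> x"
    by (auto simp: upper_part_def)
qed

theorem theorem2:
  fixes i :: "'x::{finite,lattice} \<Rightarrow> 'l::{finite,lattice}"
    and e :: "'l \<Rightarrow> 'x"
    and F :: "'l set"
    and f :: "'l \<Rightarrow> 'l"
  assumes "galois_connection i e"
    and "subconfluence F"
    and "\<forall>t\<in>F. f t = (interior_op F t \<circ> i \<circ> e) t"
  shows "closure_operator_on F f"
proof -
  define c where "c = i \<circ> e"
  have c_mono: "mono c" and c_ext: "l \<le> c l" and c_idem: "c (c l) = c l" for l
    unfolding c_def using galois_connection_closure[OF assms(1)] by blast+
  have f: "f t = interior_op F t (c t)" if "t \<in> F" for t
    using assms(3) that by (simp add: c_def)
  \<comment> \<open>Extensivity of \<open>c\<close> puts \<open>c t\<close> above \<open>t\<close>,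
    where \<open>interior_op F t\<close> is meaningful.\<close>
  have f_in: "f t \<in> F" and f_ext: "t \<le> f t" and f_le: "f t \<le> c t" if "t \<in> F" for t
    using interior_op_in[OF assms(2) that c_ext] interior_op_ge[OF assms(2) that c_ext]
      interior_op_le[OF assms(2) that c_ext] f[OF that] by simp_all
  have f_upper: "q \<le> f t" if "t \<in> F" "q \<in> F" "t \<le> q" "q \<le> c t" for q t
    using interior_op_upper[OF finite that(2-4)] f[OF that(1)] by simp
  have f_mono: "f s \<le> f t" if "s \<in> F" "t \<in> F" "s \<le> t" for s t
  proof -
    have "sup (f s) t \<in> F"
      using subconfluence_sup[OF assms(2)] that f_in f_ext by blast
    \<comment> \<open>Here \<open>f s \<le> c s \<le> c t\<close>.\<close>
    moreover have "sup (f s) t \<le> c t"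
      using order_trans[OF f_le monoD[OF c_mono]] that c_ext by simp
    ultimately have "sup (f s) t \<le> f t"
      by (intro f_upper[OF that(2)]) simp_all
    then show ?thesis
      by simp
  qed
  have "f (f t) = f t" if "t \<in> F" for t
  proof (rule order.antisym)
    \<comment> \<open>Since \<open>c (f t) \<le> c (c t) = c t\<close>, the element
      \<open>f (f t)\<close> of \<open>F\<close> lies between \<open>t\<close> and
      \<open>c t\<close>, so \<open>f_upper\<close> bounds it by \<open>f t\<close>.\<close>
    have "f (f t) \<le> c (f t)"
      using f_le f_in that by blast
    also have "\<dots> \<le> c t"
      using monoD[OF c_mono f_le] that c_idem by metis
    finally show "f (f t) \<le> f t"
      using f_upper f_in f_ext that order_trans by metis
  qed (simp add: f_ext f_in that)
  then show ?thesis
    unfolding closure_operator_on_def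
    using f_in f_ext f_mono by (auto intro: mono_onI)
qed

end
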